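(* Let $f:\mathbb{R}\to\mathbb{R}\cup\{+\infty\}$ be a univariate convex piecewise linear-quadratic (plq) function, $\bar{x}\in\operatorname{dom}(f)$ and $\epsilon>0$. Write $\partial_\epsilon f(\bar{x})=[v_l,v_u]$. Then one of the following holds. 1. If $f^\ast$ is represented by a single row $\mathrm{plq}f^\ast=[\,s_0\ \ \tilde a_0\ \ \tilde b_0\ \ \tilde c_0\,]$ with $s_0\in\mathbb{R}$, then $f^\ast(s)=\iota_{\{s_0\}}(s)+\tilde c_0$ and $\tilde a_0=\tilde b_0=0$; so $\operatorname{dom}(f^\ast)=\{s_0\}$ and $v_l=v_u=s_0$. In this case $f$ is the (affine) function $f(x)=s_0x-\tilde c_0$, with $\tilde c_0\in\mathbb{R}$. 2. Otherwise, let $l_{\bar{x}}(s)=\epsilon-f(\bar{x})+s\bar{x}$ (represented by the row $[\,+\infty\ \ 0\ \ \bar{x}\ \ \epsilon-f(\bar{x})\,]$) and let $m(s)=\min\{f^\ast(s),l_{\bar{x}}(s)\}$ have plq matrix representation with rows $[\,\hat s_i\ \ \hat a_i\ \ \hat b_i\ \ \hat c_i\,]$, $i=0,1,\dots,k$. Then: (a) If $k=0$, then $\hat s_0=+\infty$, $v_l=-\infty$ and $v_u=+\infty$. In this case $f$ is the indicator function of $\{\bar{x}\}$ plus a constant: $f=\iota_{\{\bar{x}\}}-\hat c_0$ with $\hat c_0\in\mathbb{R}$. (b) If $k\ge 1$, then $\hat s_0\in\mathbb{R}$, $\hat s_{k-1}\in\mathbb{R}$, $$v_l=\begin{cases}\hat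 s_0,&\text{if }(\hat a_0,\hat b_0,\hat c_0)=(0,\bar{x},\epsilon-f(\bar{x})),\\-\infty,&\text{otherwise,}\end{cases}\qquad v_u=\begin{cases}\hat s_{k-1},&\text{if }(\hat a_k,\hat b_k,\hat c_k)=(0,\bar{x},\epsilon-f(\bar{x})),\\+\infty,&\text{otherwise.}\end{cases}$$
   Context: Definitions. $\operatorname{dom}(f)=\{x:f(x)\in\mathbb{R}\}$; $f^\ast(s)=\sup_{x\in\mathbb{R}}\{sx-f(x)\}$; $\partial_\epsilon f(x)=\{s\in\mathbb{R}: f(y)\ge f(x)+s(y-x)-\epsilon\ \forall y\in\mathbb{R}\}$ for $x\in\operatorname{dom}(f)$; $\iota_{\{p\}}$ is $0$ at $p$ and $+\infty$ elsewhere. A function $f:\mathbb{R}\to\mathbb{R}\cup\{+\infty\}$ is plq if $\operatorname{dom}(f)$ is a union of finitely many polyhedral sets (closed intervals, possibly unbounded or single points), relative to each of which $f$ is given by a polynomial $ax^2+bx+c$ of degree at most two; in particular $f$ is continuous on $\operatorname{dom}(f)$. The Fenchel conjugate of a proper plq convex function is again a plq function. Interval convention. $\partial_\epsilon f(\bar{x})$ is a nonempty closed interval with infimum $v_l$ and supremum $v_u$ in $[-\infty,+\infty]$; $[v_l,v_u]$ denotes $\{s\in\mathbb{R}: v_l\le s\le v_u\}$. Matrix representation. A univariate function $g$ that is piecewise (at most) quadratic, possibly with value $+\infty$ on its first and/or last piece, is stored as a matrix with rows $[\,s_i\ \ a_i\ \ b_i\ \ c_i\,]$, $i=0,\dots,k$,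 where $s_0<s_1<\dots<s_{k-1}<s_k=+\infty$: with $s_{-1}=-\infty$, $g(s)=a_is^2+b_is+c_i$ on the open interval $s_{i-1}<s<s_i$, where $a_i,b_i\in\mathbb{R}$, $c_i\in\mathbb{R}$ for $0<i<k$, $c_0,c_k\in\mathbb{R}\cup\{+\infty\}$, and $c_i=+\infty$ forces $a_i=b_i=0$. If $g$ is a single quadratic on all of $\mathbb{R}$, then $k=0$ and $s_0=+\infty$. The one exceptional case is $g=\iota_{\{\tilde s\}}+c$ with $\tilde s,c\in\mathbb{R}$, which is stored as the single row $[\,\tilde s\ \ 0\ \ 0\ \ c\,]$; a single row with finite first entry always has this meaning. The same data structure is used for $m$, although $m$ may be discontinuous at a breakpoint. The representation of $m$ is the smallest one, i.e. consecutive rows satisfy $(\hat a_i,\hat b_i,\hat c_i)\ne(\hat a_{i+1},\hat b_{i+1},\hat c_{i+1})$. *)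

theory Defs
  imports "HOL-Analysis.Analysis"
begin

definition edom :: "(real \<Rightarrow> ereal) \<Rightarrow> real set" where
  "edom f = {x. \<bar>f x\<bar> \<noteq> \<infinity>}"

text \<open>The library's \<^const>\<open>convex_on\<close> does not apply to functions with values in \<^typ>\<open>ereal\<close>.
  The inequality below is only meaningful for functions that avoid \<open>-\<infinity>\<close>; since
  \<open>0 * \<infinity> = 0\<close> in \<^typ>\<open>ereal\<close>, the endpoints \<open>t = 0\<close> and \<open>t = 1\<close> impose nothing.\<close>

definition econvex :: "(real \<Rightarrow> ereal) \<Rightarrow> bool" where
  "econvex f \<longleftrightarrow> (\<forall>x y. \<forall>t\<in>{0..1}. f ((1 - t) * x + t * y) \<le> ereal (1 - t) * f x + ereal t * f y)"

definition plq :: "(real \<Rightarrow> ereal) \<Rightarrow> bool" where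
  "plq f \<longleftrightarrow>
    (\<exists>\<P>. finite \<P> \<and> edom f = \<Union>\<P> \<and>
      (\<forall>P\<in>\<P>. polyhedron P \<and> (\<exists>a b c. \<forall>x\<in>P. f x = ereal (a * x\<^sup>2 + b * x + c))))"

definition fenchel_conj :: "(real \<Rightarrow> ereal) \<Rightarrow> real \<Rightarrow> ereal" where
  "fenchel_conj f s = (SUP x. ereal (s * x) - f x)"

definition eps_subdifferential :: "real \<Rightarrow> (real \<Rightarrow> ereal) \<Rightarrow> real \<Rightarrow> real set" where
  "eps_subdifferential \<epsilon> f x = {s. \<forall>y. f y \<ge> f x + ereal (s * (y - x)) - ereal \<epsilon>}"

definition iota :: "real \<Rightarrow> real \<Rightarrow> ereal" where
  "iota p s = (if s = p then 0 else \<infinity>)"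

text \<open>A row \<open>(s, a, b, c)\<close> of a matrix representation: right breakpoint and coefficients.\<close>

type_synonym plq_row = "ereal \<times> real \<times> real \<times> ereal"

abbreviation breakpoint :: "plq_row \<Rightarrow> ereal" where
  "breakpoint r \<equiv> fst r"

abbreviation row_coeffs :: "plq_row \<Rightarrow> real \<times> real \<times> ereal" where
  "row_coeffs r \<equiv> snd r"

abbreviation const_coeff :: "plq_row \<Rightarrow> ereal" where
  "const_coeff r \<equiv> snd (snd (snd r))"

text \<open>The left end of the \<open>i\<close>-th piece, with the convention \<open>s\<^bsub>-1\<^esub> = -\<infinity>\<close>.\<close>

definition left_end :: "plq_row list \<Rightarrow> nat \<Rightarrow> ereal" where
  "left_end M i = (if i = 0 then -\<infinity> else breakpoint (M ! (i - 1)))"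

text \<open>The ordinary (not point-indicator) representation, with rows \<open>0, \<dots>, length M - 1\<close>.
  The ordering condition, starting from \<open>-\<infinity>\<close> and ending at \<open>\<infinity>\<close>, makes every breakpoint but
  the last a real number. Values at breakpoints are deliberately left unconstrained.\<close>

definition piecewise_matrix :: "plq_row list \<Rightarrow> (real \<Rightarrow> ereal) \<Rightarrow> bool" where
  "piecewise_matrix M g \<longleftrightarrow>
    M \<noteq> [] \<and> breakpoint (last M) = \<infinity> \<and>
    (\<forall>i < length M. left_end M i < breakpoint (M ! i)) \<and>
    (\<forall>i < length M. \<forall>a b c. row_coeffs (M ! i) = (a, b, c) \<longrightarrow>
      c \<noteq> -\<infinity> \<and>
      (c = \<infinity> \<longrightarrow> (i = 0 \<or> i = length M - 1) \<and> a = 0 \<and> b = 0) \<and>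
      (\<forall>s. left_end M i < ereal s \<and> ereal s < breakpoint (M ! i) \<longrightarrow>
        g s = ereal (a * s\<^sup>2 + b * s) + c)) \<and>
    ((\<exists>a b c. \<forall>s. g s = ereal (a * s\<^sup>2 + b * s + c)) \<longrightarrow> length M = 1)"

text \<open>A point indicator plus a constant is stored only as the exceptional single row, never as
  two rows that are infinite on either side of the point; conversely a single row with finite
  breakpoint represents nothing else.\<close>

definition plq_matrix :: "plq_row list \<Rightarrow> (real \<Rightarrow> ereal) \<Rightarrow> bool" where
  "plq_matrix M g \<longleftrightarrow>
    (if \<exists>p c. g = (\<lambda>s. iota p s + ereal c)
     then \<exists>p c. g = (\<lambda>s. iota p s + ereal c) \<and> M = [(ereal p, 0, 0, ereal c)]
     else piecewise_matrix M g)"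

definition minimal_plq_matrix :: "plq_row list \<Rightarrow> (real \<Rightarrow> ereal) \<Rightarrow> bool" where
  "minimal_plq_matrix M g \<longleftrightarrow>
    plq_matrix M g \<and> (\<forall>i. Suc i < length M \<longrightarrow> row_coeffs (M ! i) \<noteq> row_coeffs (M ! Suc i))"

text \<open>The interval convention: at a point of the domain, the \<open>\<epsilon>\<close>-subdifferential is the set of
  reals between its infimum and its supremum in \<^typ>\<open>ereal\<close>.\<close>

lemma eps_subdifferential_eq_interval:
  fixes f :: "real \<Rightarrow> ereal" and x \<epsilon> :: real
  assumes "x \<in> edom f"
  defines "S \<equiv> eps_subdifferential \<epsilon> f x"
  shows "S = {s. Inf (ereal ` S) \<le> ereal s \<and> ereal s \<le> Sup (ereal ` S)}"
proof
  show "S \<subseteq> {s. Inf (ereal ` S) \<le> ereal s \<and> ereal s \<le> Sup (ereal ` S)}"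
    by (auto intro: Inf_lower Sup_upper)
next
  obtain r where r: "f x = ereal r"
    using assms by (auto simp: edom_def)
  have clS: "closed S"
  proof -
    have "S = (\<Inter>y. {s. f x + ereal (s * (y - x)) - ereal \<epsilon> \<le> f y})"
      by (auto simp: S_def eps_subdifferential_def)
    moreover have "closed {s. f x + ereal (s * (y - x)) - ereal \<epsilon> \<le> f y}" for y
    proof (cases "f y")
      case (real q)
      have "closed {s. r + s * (y - x) - \<epsilon> \<le> q}"
        by (intro closed_Collect_le continuous_intros)
      then show ?thesis by (simp add: r real)
    qed (auto simp: r)
    ultimately show ?thesis by auto
  qed
  have intS: "t \<in> S" if "s \<in> S" "s' \<in> S" "s \<le> t" "t \<le> s'" for s s' t
  proof -
    have "f x + ereal (t * (y - x)) - ereal \<epsilon> \<le> f y" for y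
    proof -
      have "t * (y - x) \<le> s * (y - x) \<or> t * (y - x) \<le> s' * (y - x)"
        using that by (cases "y \<ge> x") (auto intro: mult_right_mono mult_right_mono_neg)
      moreover have "f x + ereal (s * (y - x)) - ereal \<epsilon> \<le> f y"
        "f x + ereal (s' * (y - x)) - ereal \<epsilon> \<le> f y"
        using that by (auto simp: S_def eps_subdifferential_def)
      ultimately show ?thesis
        by (cases "f y") (auto simp: r)
    qed
    then show ?thesis by (simp add: S_def eps_subdifferential_def)
  qed
  show "{s. Inf (ereal ` S) \<le> ereal s \<and> ereal s \<le> Sup (ereal ` S)} \<subseteq> S"
  proof (clarify, rule ccontr)
    fix t assume t: "Inf (ereal ` S) \<le> ereal t" "ereal t \<le> Sup (ereal ` S)" "t \<notin> S"
    obtain d where d: "d > 0" "ball t d \<inter> S = {}"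
    proof -
      have "open (- S)" "t \<in> - S" using clS t(3) by auto
      then obtain d where "d > 0" "ball t d \<subseteq> - S" using open_contains_ball by blast
      then show ?thesis using that by blast
    qed
    have "Inf (ereal ` S) < ereal (t + d)" "ereal (t - d) < Sup (ereal ` S)"
      using le_less_trans[OF t(1)] less_le_trans[OF _ t(2)] d(1) by simp_all
    then obtain s s' where s: "s \<in> S" "s < t + d" "s' \<in> S" "t - d < s'"
      by (auto simp: Inf_less_iff less_Sup_iff)
    have "s \<notin> ball t d" "s' \<notin> ball t d" using s d by auto
    then have "s \<le> t" "t \<le> s'" using s d(1) by (auto simp: dist_real_def)
    then show False using intS s t by blast
  qed
qed

end

theory Submission
  imports Defs
begin

text \<open>
  Let \<open>l\<close> be the affine function \<open>s \<mapsto> \<epsilon> - f xbar + s xbar\<close>. Rearranging the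
  subgradient inequality and taking the supremum over all test points shows that the
  \<open>\<epsilon>\<close>-subdifferential is the sublevel set where the conjugate is at most \<open>l\<close>
  (\<open>eps_subdifferential_eq_conj_le\<close>). Its ends have to be recognised in the minimum \<open>m\<close> of the
  two functions.

  Two facts make this possible. First, the conjugate is strictly below \<open>l\<close> somewhere, since
  \<open>f xbar\<close> is the supremum of \<open>s xbar - f\<^sup>*(s)\<close>; this is the Fenchel-Moreau theorem
  (\<open>fenchel_biconj\<close>), which on the line follows from separating a point from the closed convex
  epigraph of \<open>f\<close>. Secondly, by convexity the sublevel set then has the same infimum and
  supremum as the strict sublevel set (\<open>sublevel_ends_eq_strict_sublevel_ends\<close>), and the latter
  is the set where \<open>m\<close> differs from \<open>l\<close>.

  The rest is about matrices only. Distinct quadratics agree on no open interval, so a row other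
  than that of \<open>l\<close> produces points of difference arbitrarily close to both ends of its piece,
  whereas the row of \<open>l\<close> produces none. In a matrix with at least two rows, the outermost row
  together with its neighbour, which minimality forces to be different, therefore determines
  the corresponding end (\<open>Inf_differs_eq_first_breakpoint\<close>, \<open>Sup_differs_eq_last_breakpoint\<close>).

  If \<open>m\<close> has a single row, it is a quadratic within \<open>\<epsilon>\<close> of \<open>l\<close>, hence \<open>l\<close> minus a
  positive constant, and the conjugate coincides with it; a conjugate that is a point indicator
  up to a constant makes the sublevel set that point. In both cases, conjugating once more gives
  \<open>f\<close>.
\<close>

section \<open>Biconjugation on the line\<close>

lemma fenchel_conj_le_iff:
  fixes f :: "real \<Rightarrow> ereal"
  assumes "\<And>x. f x \<noteq> -\<infinity>"
  shows "fenchel_conj f s \<le> ereal \<beta> \<longleftrightarrow> (\<forall>y. ereal (s * y - \<beta>) \<le> f y)"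
proof -
  have "ereal (s * y) - f y \<le> ereal \<beta> \<longleftrightarrow> ereal (s * y - \<beta>) \<le> f y" for y
    using assms[of y] by (cases "f y") auto
  then show ?thesis
    by (simp add: fenchel_conj_def SUP_le_iff)
qed

definition epigraph :: "(real \<Rightarrow> ereal) \<Rightarrow> (real \<times> real) set" where
  "epigraph f = {(x, r). f x \<le> ereal r}"

lemma convex_epigraph:
  assumes "\<And>x. f x \<noteq> -\<infinity>" "econvex f"
  shows "convex (epigraph f)"
proof (rule convexI)
  fix z w :: "real \<times> real" and u v :: real
  assume zw: "z \<in> epigraph f" "w \<in> epigraph f" and uv: "0 \<le> u" "0 \<le> v" "u + v = 1"
  obtain x r y q where [simp]: "z = (x, r)" "w = (y, q)"
    by (cases z, cases w)
  have fx: "f x \<le> ereal r" and fy: "f y \<le> ereal q"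
    using zw by (auto simp: epigraph_def)
  have "f (u * x + v * y) \<le> ereal u * f x + ereal v * f y"
    using assms(2)[unfolded econvex_def, rule_format, of v x y] uv by (simp add: eq_diff_eq[symmetric])
  also have "\<dots> \<le> ereal (u * r + v * q)"
    using fx fy uv assms(1)[of x] assms(1)[of y]
    by (cases "f x"; cases "f y") (auto intro!: add_mono mult_left_mono)
  finally show "u *\<^sub>R z + v *\<^sub>R w \<in> epigraph f"
    by (simp add: epigraph_def)
qed

text \<open>Over each of the finitely many closed pieces of the domain the epigraph is the region
  above a continuous graph. This is where lower semicontinuity comes from.\<close>

lemma closed_epigraph:
  assumes "\<And>x. f x \<noteq> -\<infinity>" "plq f"
  shows "closed (epigraph f)"
proof -
  obtain \<P> where fin: "finite \<P>" and dom: "edom f = \<Union>\<P>"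
    and P: "\<forall>P\<in>\<P>. polyhedron P \<and> (\<exists>a b c. \<forall>x\<in>P. f x = ereal (a * x\<^sup>2 + b * x + c))"
    using assms(2) unfolding plq_def by (elim exE conjE)
  have "fst z \<in> \<Union>\<P>" if "z \<in> epigraph f" for z
    using that assms(1)[of "fst z"] unfolding dom[symmetric]
    by (auto simp: edom_def epigraph_def)
  then have union: "epigraph f = (\<Union>P\<in>\<P>. {z \<in> epigraph f. fst z \<in> P})" by blast
  have pieces: "closed {z \<in> epigraph f. fst z \<in> P}" if mem: "P \<in> \<P>" for P
  proof -
    obtain a b c where q: "\<forall>x\<in>P. f x = ereal (a * x\<^sup>2 + b * x + c)" and "polyhedron P"
      using bspec[OF P mem] by (elim exE conjE)
    have "{z \<in> epigraph f. fst z \<in> P} =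
        (P \<times> UNIV) \<inter> {z. a * (fst z)\<^sup>2 + b * fst z + c \<le> snd z}"
      using q by (auto simp: epigraph_def)
    moreover have "closed (P \<times> (UNIV :: real set))"
      using \<open>polyhedron P\<close> by (intro closed_Times polyhedron_imp_closed closed_UNIV)
    moreover have "closed {z :: real \<times> real. a * (fst z)\<^sup>2 + b * fst z + c \<le> snd z}"
      by (intro closed_Collect_le continuous_intros)
    ultimately show ?thesis by (simp add: closed_Int)
  qed
  show ?thesis
    by (subst union) (use fin pieces in \<open>blast intro: closed_UN\<close>)
qed

text \<open>Separate the point \<open>(x, r)\<close> below the graph from the epigraph. A line that is not
  vertical is the wanted minorant. A vertical one is impossible over the domain, and
  elsewhere it only says that some point strictly separates \<open>x\<close> from the domain: then a
  minorant obtained over the domain can be tilted about that point, falling on the domain's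
  side, until it exceeds \<open>r\<close> at \<open>x\<close>.\<close>

lemma affine_minorant_above:
  fixes f :: "real \<Rightarrow> ereal"
  assumes ninf: "\<And>x. f x \<noteq> -\<infinity>" and conv: "econvex f" and "plq f" and x0: "x0 \<in> edom f"
    and r: "ereal r < f x"
  shows "\<exists>s \<beta>. (\<forall>y. ereal (s * y - \<beta>) \<le> f y) \<and> r < s * x - \<beta>"
proof -
  obtain F where F: "f x0 = ereal F"
    using x0 by (auto simp: edom_def)
  have cc: "convex (epigraph f)" "closed (epigraph f)"
    using assms convex_epigraph closed_epigraph by blast+
  have sep: "\<exists>p q b. 0 \<le> q \<and> p * x + q * r < b \<and> (\<forall>y t. f y \<le> ereal t \<longrightarrow> b < p * y + q * t)"
    if "ereal r < f x" for x r
  proof -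
    have "(x, r) \<notin> epigraph f" using that by (simp add: epigraph_def not_le)
    then obtain a b where ab: "inner a (x, r) < b" "\<forall>z\<in>epigraph f. b < inner a z"
      using separating_hyperplane_closed_point[OF cc] by blast
    obtain p q where [simp]: "a = (p, q)" by (cases a)
    have above: "b < p * y + q * t" if "f y \<le> ereal t" for y t
      using ab(2) that by (force simp: epigraph_def)
    have "0 \<le> q"
    proof (rule ccontr)
      assume "\<not> 0 \<le> q"
      \<comment> \<open>Going up the vertical ray over \<open>x0\<close> would leave the half-plane.\<close>
      define t where "t = max F ((b - p * x0) / q)"
      have "b < p * x0 + q * t"
        by (rule above) (simp add: F t_def)
      moreover have "q * t \<le> b - p * x0"
        using \<open>\<not> 0 \<le> q\<close> mult_left_mono_neg[of "(b - p * x0) / q" t q] by (simp add: t_def)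
      ultimately show False by simp
    qed
    then show ?thesis using ab(1) above by auto
  qed
  have nonvertical: "(\<forall>y. ereal (- p / q * y - - b / q) \<le> f y) \<and> r < - p / q * x - - b / q"
    if "0 < q" "p * x + q * r < b" "\<forall>y t. f y \<le> ereal t \<longrightarrow> b < p * y + q * t" for p q b x r
  proof -
    have "ereal (- p / q * y - - b / q) \<le> f y" for y
    proof (cases "f y")
      case (real t)
      then have "b < p * y + q * t" using that(3) by simp
      then show ?thesis using real \<open>0 < q\<close> by (simp add: field_simps)
    qed (use ninf in auto)
    moreover have "r < - p / q * x - - b / q"
      using that(1,2) by (simp add: field_simps)
    ultimately show ?thesis by blast
  qed
  obtain p q b where pqb: "0 \<le> q" "p * x + q * r < b" "\<forall>y t. f y \<le> ereal t \<longrightarrow> b < p * y + q * t"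
    using sep[OF r] by blast
  show ?thesis
  proof (cases "q = 0")
    case False
    then have "0 < q" using pqb(1) by simp
    then show ?thesis using nonvertical[OF _ pqb(2,3)] by blast
  next
    case True
    obtain p' q' b' where pqb': "0 \<le> q'" "p' * x0 + q' * (F - 1) < b'"
        "\<forall>y t. f y \<le> ereal t \<longrightarrow> b' < p' * y + q' * t"
      using sep[of "F - 1" x0] by (auto simp: F)
    have "q' \<noteq> 0"
      using pqb'(2) pqb'(3)[rule_format, of x0 F] F by auto
    then obtain s \<beta> where s: "\<forall>y. ereal (s * y - \<beta>) \<le> f y"
      using nonvertical[OF _ pqb'(2,3)] pqb'(1) by fastforce
    have gap: "0 < b - p * x" using pqb(2) True by simp
    define n where "n = (max 0 (r - (s * x - \<beta>)) + 1) / (b - p * x)"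
    have n: "0 \<le> n" "r < s * x - \<beta> + n * (b - p * x)"
      using gap by (auto simp: n_def)
    have "ereal ((s - n * p) * y - (\<beta> - n * b)) \<le> f y" for y
    proof (cases "f y")
      case (real t)
      then have "n * b \<le> n * (p * y)"
        using pqb(3)[rule_format, of y t] True n(1) by (simp add: mult_left_mono)
      moreover have "s * y - \<beta> \<le> t" using s[rule_format, of y] real by simp
      ultimately show ?thesis using real by (simp add: algebra_simps)
    qed (use ninf in auto)
    moreover have "r < (s - n * p) * x - (\<beta> - n * b)"
      using n(2) by (simp add: algebra_simps)
    ultimately show ?thesis by blast
  qed
qed

lemma fenchel_biconj:
  fixes f :: "real \<Rightarrow> ereal"
  assumes ninf: "\<And>x. f x \<noteq> -\<infinity>" and "econvex f" "plq f" "x0 \<in> edom f"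
  shows "fenchel_conj (fenchel_conj f) = f"
proof (rule ext, rule antisym)
  fix x
  show "fenchel_conj (fenchel_conj f) x \<le> f x"
    unfolding fenchel_conj_def[of "fenchel_conj f"]
  proof (rule SUP_least)
    fix s
    have "ereal (s * x) - f x \<le> fenchel_conj f s"
      unfolding fenchel_conj_def by (rule SUP_upper) simp
    then show "ereal (x * s) - fenchel_conj f s \<le> f x"
      using ninf[of x] by (cases "f x"; cases "fenchel_conj f s") (auto simp: mult.commute)
  qed
  show "f x \<le> fenchel_conj (fenchel_conj f) x"
  proof (rule ereal_le_real)
    fix z assume z: "fenchel_conj (fenchel_conj f) x \<le> ereal z"
    show "f x \<le> ereal z"
    proof (rule ccontr)
      assume "\<not> f x \<le> ereal z"
      then obtain s \<beta> where s: "\<forall>y. ereal (s * y - \<beta>) \<le> f y" "z < s * x - \<beta>"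
        using affine_minorant_above[OF assms, of z x] by (auto simp: not_le)
      have "fenchel_conj f s \<le> ereal \<beta>"
        using s(1) by (simp add: fenchel_conj_le_iff[of f, OF ninf])
      then have "ereal (s * x - \<beta>) \<le> ereal (x * s) - fenchel_conj f s"
        by (cases "fenchel_conj f s") (auto simp: mult.commute)
      also have "\<dots> \<le> fenchel_conj (fenchel_conj f) x"
        unfolding fenchel_conj_def[of "fenchel_conj f"] by (rule SUP_upper) simp
      also note z
      finally show False using s(2) by simp
    qed
  qed
qed

lemma fenchel_conj_point_indicator:
  "fenchel_conj (\<lambda>s. iota p s + ereal c) = (\<lambda>x. ereal (p * x) - ereal c)"
proof
  fix x
  show "fenchel_conj (\<lambda>s. iota p s + ereal c) x = ereal (p * x) - ereal c"
    unfolding fenchel_conj_def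
  proof (rule antisym)
    show "(SUP s. ereal (x * s) - (iota p s + ereal c)) \<le> ereal (p * x) - ereal c"
      by (rule SUP_least) (auto simp: iota_def mult.commute)
    show "ereal (p * x) - ereal c \<le> (SUP s. ereal (x * s) - (iota p s + ereal c))"
      by (rule SUP_upper2[of p]) (auto simp: iota_def mult.commute)
  qed
qed

lemma fenchel_conj_affine:
  "fenchel_conj (\<lambda>s. ereal (p * s + c)) = (\<lambda>x. iota p x - ereal c)"
proof
  fix x
  show "fenchel_conj (\<lambda>s. ereal (p * s + c)) x = iota p x - ereal c"
  proof (cases "x = p")
    case True
    then show ?thesis by (simp add: fenchel_conj_def iota_def)
  next
    case False
    have "fenchel_conj (\<lambda>s. ereal (p * s + c)) x = \<infinity>"
    proof (rule ereal_top)
      fix B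
      define t where "t = (B + c) / (x - p)"
      have "(x - p) * t = B + c" using False by (simp add: t_def)
      then have "x * t - p * t = B + c" by (simp only: left_diff_distrib)
      then have "ereal B \<le> ereal (x * t) - ereal (p * t + c)" by simp
      then show "ereal B \<le> fenchel_conj (\<lambda>s. ereal (p * s + c)) x"
        unfolding fenchel_conj_def by (rule SUP_upper2[OF UNIV_I])
    qed
    then show ?thesis using False by (simp add: iota_def)
  qed
qed

section \<open>The subdifferential as a sublevel set of the conjugate\<close>

lemma fenchel_conj_convex_bound:
  assumes ninf: "\<And>x. f x \<noteq> -\<infinity>"
    and "fenchel_conj f s \<le> ereal \<beta>" "fenchel_conj f s' \<le> ereal \<beta>'" "0 \<le> t" "t \<le> 1"
  shows "fenchel_conj f ((1 - t) * s + t * s') \<le> ereal ((1 - t) * \<beta> + t * \<beta>')"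
  unfolding fenchel_conj_le_iff[of f, OF ninf]
proof
  fix y
  have le: "ereal (s * y - \<beta>) \<le> f y" "ereal (s' * y - \<beta>') \<le> f y"
    using assms(2,3) unfolding fenchel_conj_le_iff[of f, OF ninf] by blast+
  show "ereal (((1 - t) * s + t * s') * y - ((1 - t) * \<beta> + t * \<beta>')) \<le> f y"
  proof (cases "f y")
    case (real v)
    have "(1 - t) * (s * y - \<beta>) + t * (s' * y - \<beta>') \<le> (1 - t) * v + t * v"
      using le real assms(4,5) by (intro add_mono mult_left_mono) auto
    then show ?thesis using real by (simp add: algebra_simps)
  qed (use ninf in auto)
qed

lemma eps_subdifferential_eq_conj_le:
  assumes ninf: "\<And>x. f x \<noteq> -\<infinity>" and F: "f x = ereal F"
  shows "eps_subdifferential \<epsilon> f x = {s. fenchel_conj f s \<le> ereal (x * s + (\<epsilon> - F))}"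
proof -
  have "f x + ereal (s * (y - x)) - ereal \<epsilon> = ereal (s * y - (x * s + (\<epsilon> - F)))" for s y
    by (simp add: F algebra_simps)
  then show ?thesis
    unfolding eps_subdifferential_def fenchel_conj_le_iff[of f, OF ninf] by simp
qed

text \<open>A convex function that is negative at \<open>s'\<close> and at most zero at \<open>s\<close> is negative on the
  segment from \<open>s'\<close> up to, but excluding, \<open>s\<close>. Here it is applied to the conjugate minus an
  affine function.\<close>

lemma fenchel_conj_less_between:
  assumes ninf: "\<And>x. f x \<noteq> -\<infinity>"
    and s: "fenchel_conj f s \<le> ereal (p * s + c)"
    and s': "fenchel_conj f s' < ereal (p * s' + c)"
    and t: "s < t \<and> t < s' \<or> s' < t \<and> t < s"
  shows "fenchel_conj f t < ereal (p * t + c)"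
proof -
  obtain \<beta> where \<beta>: "fenchel_conj f s' \<le> ereal \<beta>" "\<beta> < p * s' + c"
    using ereal_dense2[OF s'] by (auto intro: less_imp_le)
  define \<theta> where "\<theta> = (t - s) / (s' - s)"
  have \<theta>: "0 < \<theta>" "\<theta> < 1"
    using t by (auto simp: \<theta>_def field_simps)
  have "\<theta> * (s' - s) = t - s" using t by (auto simp: \<theta>_def)
  then have t_eq: "t = (1 - \<theta>) * s + \<theta> * s'" by (simp add: algebra_simps)
  have "fenchel_conj f t \<le> ereal ((1 - \<theta>) * (p * s + c) + \<theta> * \<beta>)"
    unfolding t_eq by (rule fenchel_conj_convex_bound[OF ninf s \<beta>(1)]) (use \<theta> in auto)
  also have "\<theta> * \<beta> < \<theta> * (p * s' + c)" using \<theta> \<beta>(2) by simp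
  then have "ereal ((1 - \<theta>) * (p * s + c) + \<theta> * \<beta>) < ereal (p * t + c)"
    by (simp add: t_eq algebra_simps)
  finally show ?thesis .
qed

text \<open>Passing to the strict sublevel set is what links the subdifferential to the minimum
  \<open>m\<close>: it consists of the points where \<open>m\<close> differs from the affine function, so its
  ends can be read off a representation of \<open>m\<close>.\<close>

lemma sublevel_ends_eq_strict_sublevel_ends:
  assumes ninf: "\<And>x. f x \<noteq> -\<infinity>"
    and s': "fenchel_conj f s' < ereal (p * s' + c)"
  defines "S \<equiv> {s. fenchel_conj f s \<le> ereal (p * s + c)}"
    and "D \<equiv> {s. fenchel_conj f s < ereal (p * s + c)}"
  shows "Inf (ereal ` S) = Inf (ereal ` D)" "Sup (ereal ` S) = Sup (ereal ` D)"
proof -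
  have sub: "ereal ` D \<subseteq> ereal ` S" by (auto simp: S_def D_def)
  have s'D: "s' \<in> D" using s' by (simp add: D_def)
  have between: "t \<in> D" if "s \<in> S" "s < t \<and> t < s' \<or> s' < t \<and> t < s" for s t
    using fenchel_conj_less_between[OF ninf _ s'] that by (auto simp: S_def D_def)
  have "Inf (ereal ` D) \<le> ereal s" if s: "s \<in> S" for s
  proof (rule ccontr)
    assume "\<not> Inf (ereal ` D) \<le> ereal s"
    then obtain t where t: "s < t" "ereal t < Inf (ereal ` D)"
      using ereal_dense2[of "ereal s" "Inf (ereal ` D)"] by (auto simp: not_le)
    have "t < s'" using less_le_trans[OF t(2) Inf_lower] s'D by force
    then have "t \<in> D" using between s t(1) by blast
    then show False using t(2) Inf_lower[of "ereal t" "ereal ` D"] by auto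
  qed
  then show "Inf (ereal ` S) = Inf (ereal ` D)"
    using Inf_superset_mono[OF sub] by (auto intro!: antisym Inf_greatest)
  have "ereal s \<le> Sup (ereal ` D)" if s: "s \<in> S" for s
  proof (rule ccontr)
    assume "\<not> ereal s \<le> Sup (ereal ` D)"
    then obtain t where t: "t < s" "Sup (ereal ` D) < ereal t"
      using ereal_dense2[of "Sup (ereal ` D)" "ereal s"] by (auto simp: not_le)
    have "s' < t" using le_less_trans[OF Sup_upper t(2)] s'D by force
    then have "t \<in> D" using between s t(1) by blast
    then show False using t(2) Sup_upper[of "ereal t" "ereal ` D"] by auto
  qed
  then show "Sup (ereal ` S) = Sup (ereal ` D)"
    using Sup_subset_mono[OF sub] by (auto intro!: antisym Sup_least)
qed

section \<open>Reading the ends off a matrix\<close>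

lemma quadratic_coeffs_eq_of_eq_on_interval:
  fixes u v :: real
  assumes "u < v" and eq: "\<And>t. u < t \<Longrightarrow> t < v \<Longrightarrow> a * t\<^sup>2 + b * t + c = a' * t\<^sup>2 + b' * t + c'"
  shows "a = a' \<and> b = b' \<and> c = c'"
proof -
  let ?p = "[:c - c', b - b', a - a':]"
  have "poly ?p t = 0" if "t \<in> {u<..<v}" for t
    using eq[of t] that by (simp add: algebra_simps power2_eq_square)
  then have "{u<..<v} \<subseteq> {t. poly ?p t = 0}" by blast
  then have "infinite {t. poly ?p t = 0}"
    using infinite_super infinite_Ioo[OF \<open>u < v\<close>] by blast
  then have "?p = 0" using poly_roots_finite by blast
  then show ?thesis by simp
qed

lemma bounded_quadratic_const:
  fixes a b c B :: real
  assumes bd: "\<And>s. \<bar>a * s\<^sup>2 + b * s + c\<bar> \<le> B"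
  shows "a = 0 \<and> b = 0"
proof -
  have B: "0 \<le> B" "\<bar>c\<bar> \<le> B" using bd[of 0] by auto
  have "a = 0"
  proof (rule ccontr)
    assume "a \<noteq> 0"
    define s where "s = sqrt ((2 * B + 1) / \<bar>a\<bar>)"
    have "\<bar>a * s\<^sup>2\<bar> = 2 * B + 1"
      using B \<open>a \<noteq> 0\<close> by (simp add: s_def abs_mult)
    \<comment> \<open>Averaging over \<open>s\<close> and \<open>-s\<close> cancels the linear term.\<close>
    moreover have "\<bar>a * s\<^sup>2 + c\<bar> \<le> B"
      using bd[of s] bd[of "- s"] by (simp add: abs_le_iff)
    ultimately show False using B by linarith
  qed
  moreover have "b = 0"
  proof (rule ccontr)
    assume "b \<noteq> 0"
    then show False using bd[of "(2 * B + 1) / b"] B \<open>a = 0\<close> by auto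
  qed
  ultimately show ?thesis ..
qed

lemma piecewise_matrix_value:
  assumes "piecewise_matrix M g" "i < length M" "row_coeffs (M ! i) = (a, b, c)"
    and "left_end M i < ereal s" "ereal s < breakpoint (M ! i)"
  shows "g s = ereal (a * s\<^sup>2 + b * s) + c"
  using assms unfolding piecewise_matrix_def by blast

lemma left_end_less_breakpoint:
  assumes "piecewise_matrix M g" "i < length M"
  shows "left_end M i < breakpoint (M ! i)"
  using assms unfolding piecewise_matrix_def by blast

lemma ex_differs_on_piece:
  assumes M: "piecewise_matrix M g" and i: "i < length M"
    and ne: "row_coeffs (M ! i) \<noteq> (a, b, ereal c)"
    and uv: "left_end M i \<le> ereal u" "u < v" "ereal v \<le> breakpoint (M ! i)"
  shows "\<exists>t. u < t \<and> t < v \<and> g t \<noteq> ereal (a * t\<^sup>2 + b * t + c)"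
proof (rule ccontr)
  assume "\<not> ?thesis"
  then have eq: "g t = ereal (a * t\<^sup>2 + b * t + c)" if "u < t" "t < v" for t
    using that by blast
  obtain a' b' c' where row: "row_coeffs (M ! i) = (a', b', c')" by (cases "row_coeffs (M ! i)")
  have g: "g t = ereal (a' * t\<^sup>2 + b' * t) + c'" if "u < t" "t < v" for t
  proof -
    have "left_end M i < ereal t" "ereal t < breakpoint (M ! i)"
      using that le_less_trans[OF uv(1)] less_le_trans[OF _ uv(3)] by auto
    then show ?thesis by (rule piecewise_matrix_value[OF M i row])
  qed
  obtain t0 where "u < t0" "t0 < v" using dense uv(2) by blast
  then obtain d where d: "c' = ereal d"
    using g[of t0] eq[of t0] by (cases c') auto
  have "a' = a \<and> b' = b \<and> d = c"
    using uv(2)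
  proof (rule quadratic_coeffs_eq_of_eq_on_interval)
    fix t assume "u < t" "t < v"
    then show "a' * t\<^sup>2 + b' * t + d = a * t\<^sup>2 + b * t + c"
      using g[of t] eq[of t] d by simp
  qed
  then show False using ne row d by simp
qed

lemma finite_breakpoint:
  assumes M: "piecewise_matrix M g" and i: "Suc i < length M"
  shows "\<exists>r. breakpoint (M ! i) = ereal r"
proof -
  have "left_end M i < breakpoint (M ! i)" "left_end M (Suc i) < breakpoint (M ! Suc i)"
    using left_end_less_breakpoint[OF M] i by auto
  then have "breakpoint (M ! i) \<noteq> -\<infinity>" "breakpoint (M ! i) \<noteq> \<infinity>"
    by (auto simp: left_end_def)
  then show ?thesis by (cases "breakpoint (M ! i)") auto
qed

text \<open>If the first row is the quadratic itself, minimality makes the second row differ from it,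
  and a row that differs does so at points arbitrarily close to its left end. If the first row
  differs, it does so at arbitrarily small arguments.\<close>

lemma Inf_differs_eq_first_breakpoint:
  assumes M: "piecewise_matrix M g" and len: "1 < length M"
    and min: "row_coeffs (M ! 0) \<noteq> row_coeffs (M ! 1)"
  shows "Inf (ereal ` {s. g s \<noteq> ereal (a * s\<^sup>2 + b * s + c)}) =
    (if row_coeffs (M ! 0) = (a, b, ereal c) then breakpoint (M ! 0) else -\<infinity>)"
    (is "Inf (ereal ` ?D) = _")
proof -
  obtain s0 where s0: "breakpoint (M ! 0) = ereal s0"
    using finite_breakpoint[OF M, of 0] len by auto
  show ?thesis
  proof (cases "row_coeffs (M ! 0) = (a, b, ereal c)")
    case True
    have below: "ereal s0 \<le> ereal s" if "s \<in> ?D" for s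
    proof (rule ccontr)
      assume "\<not> ereal s0 \<le> ereal s"
      then have "g s = ereal (a * s\<^sup>2 + b * s) + ereal c"
        using piecewise_matrix_value[OF M _ True, of s] s0 len
        by (cases "M = []") (auto simp: left_end_def)
      then show False using that by simp
    qed
    have "ereal s0 \<le> Inf (ereal ` ?D)"
      by (rule Inf_greatest) (use below in blast)
    moreover have "Inf (ereal ` ?D) \<le> ereal s0"
    proof (rule ccontr)
      assume "\<not> ?thesis"
      moreover have "ereal s0 < breakpoint (M ! 1)"
        using left_end_less_breakpoint[OF M len] s0 by (simp add: left_end_def)
      ultimately obtain v where v: "s0 < v" "ereal v < Inf (ereal ` ?D)" "ereal v < breakpoint (M ! 1)"
        using ereal_dense2[of "ereal s0" "min (Inf (ereal ` ?D)) (breakpoint (M ! 1))"]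
        by (auto simp: not_le)
      obtain t where "t < v" "t \<in> ?D"
        using ex_differs_on_piece[OF M len, of a b c s0 v] min True s0 v
        by (auto simp: left_end_def less_imp_le)
      note v(2)
      also have "Inf (ereal ` ?D) \<le> ereal t"
        using \<open>t \<in> ?D\<close> by (intro Inf_lower imageI)
      finally show False using \<open>t < v\<close> by simp
    qed
    ultimately show ?thesis
      using True s0 by (simp add: antisym)
  next
    case False
    have "Inf (ereal ` ?D) \<le> ereal B" for B
    proof -
      define v where "v = min B s0"
      have v: "v \<le> B" "v \<le> s0" by (simp_all add: v_def)
      obtain t where "t < v" "t \<in> ?D"
        using ex_differs_on_piece[OF M _ False, of "v - 1" v] s0 len v
        by (cases "M = []") (auto simp: left_end_def)
      then show ?thesis
        using v by (intro Inf_lower2[of "ereal t"]) auto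
    qed
    then show ?thesis using False ereal_bot by auto
  qed
qed

lemma Sup_differs_eq_last_breakpoint:
  assumes M: "piecewise_matrix M g" and len: "length M = Suc (Suc j)"
    and min: "row_coeffs (M ! j) \<noteq> row_coeffs (M ! Suc j)"
  shows "Sup (ereal ` {s. g s \<noteq> ereal (a * s\<^sup>2 + b * s + c)}) =
    (if row_coeffs (M ! Suc j) = (a, b, ereal c) then breakpoint (M ! j) else \<infinity>)"
    (is "Sup (ereal ` ?D) = _")
proof -
  obtain s1 where s1: "breakpoint (M ! j) = ereal s1"
    using finite_breakpoint[OF M, of j] len by auto
  have last: "breakpoint (M ! Suc j) = \<infinity>"
    using M len unfolding piecewise_matrix_def by (auto simp: last_conv_nth)
  show ?thesis
  proof (cases "row_coeffs (M ! Suc j) = (a, b, ereal c)")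
    case True
    have above: "ereal s \<le> ereal s1" if "s \<in> ?D" for s
    proof (rule ccontr)
      assume "\<not> ereal s \<le> ereal s1"
      then have "g s = ereal (a * s\<^sup>2 + b * s) + ereal c"
        using piecewise_matrix_value[OF M _ True, of s] s1 last len by (simp add: left_end_def)
      then show False using that by simp
    qed
    have "Sup (ereal ` ?D) \<le> ereal s1"
      by (rule Sup_least) (use above in blast)
    moreover have "ereal s1 \<le> Sup (ereal ` ?D)"
    proof (rule ccontr)
      assume "\<not> ?thesis"
      moreover have "left_end M j < ereal s1"
        using left_end_less_breakpoint[OF M, of j] len s1 by simp
      ultimately obtain u where u: "u < s1" "Sup (ereal ` ?D) < ereal u" "left_end M j < ereal u"
        using ereal_dense2[of "max (Sup (ereal ` ?D)) (left_end M j)" "ereal s1"]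
        by (auto simp: not_le)
      obtain t where "u < t" "t \<in> ?D"
        using ex_differs_on_piece[OF M, of j a b c u s1] min True s1 u len
        by (auto dest: less_imp_le)
      have "ereal t \<le> Sup (ereal ` ?D)"
        using \<open>t \<in> ?D\<close> by (intro Sup_upper imageI)
      also note u(2)
      finally show False using \<open>u < t\<close> by simp
    qed
    ultimately show ?thesis
      using True s1 by (simp add: antisym)
  next
    case False
    have "ereal B \<le> Sup (ereal ` ?D)" for B
    proof -
      define u where "u = max B s1"
      have u: "B \<le> u" "s1 \<le> u" by (simp_all add: u_def)
      obtain t where "u < t" "t \<in> ?D"
        using ex_differs_on_piece[OF M _ False, of u "u + 1"] s1 last len u
        by (auto simp: left_end_def)
      then show ?thesis
        using u by (intro Sup_upper2[of "ereal t"]) auto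
    qed
    then show ?thesis using False ereal_top by auto
  qed
qed

section \<open>The subdifferential read off the conjugate\<close>

theorem theorem3p1:
  fixes f l m :: "real \<Rightarrow> ereal" and xbar \<epsilon> :: real and vl vu :: ereal
  assumes "\<And>x. f x \<noteq> -\<infinity>"
    and "econvex f"
    and "plq f"
    and "xbar \<in> edom f"
    and "\<epsilon> > 0"
    and "vl = Inf (ereal ` eps_subdifferential \<epsilon> f xbar)"
    and "vu = Sup (ereal ` eps_subdifferential \<epsilon> f xbar)"
    and "l = (\<lambda>s. ereal \<epsilon> - f xbar + ereal (s * xbar))"
    and "m = (\<lambda>s. min (fenchel_conj f s) (l s))"
  shows
    "(\<forall>(s0::real) a b c. plq_matrix [(ereal s0, a, b, c)] (fenchel_conj f) \<longrightarrow>
        fenchel_conj f = (\<lambda>s. iota s0 s + c) \<and> a = 0 \<and> b = 0 \<and>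
        edom (fenchel_conj f) = {s0} \<and>
        vl = ereal s0 \<and> vu = ereal s0 \<and>
        \<bar>c\<bar> \<noteq> \<infinity> \<and> f = (\<lambda>x. ereal (s0 * x) - c))
     \<and>
     ((\<nexists>(s0::real) a b c. plq_matrix [(ereal s0, a, b, c)] (fenchel_conj f)) \<longrightarrow>
        plq_matrix [(\<infinity>, 0, xbar, ereal \<epsilon> - f xbar)] l \<and>
        (\<forall>M k. minimal_plq_matrix M m \<and> length M = Suc k \<longrightarrow>
          (k = 0 \<longrightarrow>
            breakpoint (M ! 0) = \<infinity> \<and> vl = -\<infinity> \<and> vu = \<infinity> \<and>
            \<bar>const_coeff (M ! 0)\<bar> \<noteq> \<infinity> \<and>
            f = (\<lambda>x. iota xbar x - const_coeff (M ! 0))) \<and>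
          (k \<ge> 1 \<longrightarrow>
            \<bar>breakpoint (M ! 0)\<bar> \<noteq> \<infinity> \<and> \<bar>breakpoint (M ! (k - 1))\<bar> \<noteq> \<infinity> \<and>
            vl = (if row_coeffs (M ! 0) = (0, xbar, ereal \<epsilon> - f xbar)
                  then breakpoint (M ! 0) else -\<infinity>) \<and>
            vu = (if row_coeffs (M ! k) = (0, xbar, ereal \<epsilon> - f xbar)
                  then breakpoint (M ! (k - 1)) else \<infinity>))))"
proof -
  note ninf = assms(1) and vl = assms(6) and vu = assms(7) and l = assms(8) and m = assms(9)
  obtain F where F: "f xbar = ereal F"
    using assms(4) by (auto simp: edom_def)
  let ?g = "fenchel_conj f" and ?c = "\<epsilon> - F"
  have bi: "fenchel_conj ?g = f"
    using fenchel_biconj[OF assms(1-4)] .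
  have row: "ereal \<epsilon> - f xbar = ereal ?c" by (simp add: F)
  have l_eq: "l s = ereal (xbar * s + ?c)" for s
    by (simp add: l F algebra_simps)
  have S: "eps_subdifferential \<epsilon> f xbar = {s. ?g s \<le> ereal (xbar * s + ?c)}"
    by (rule eps_subdifferential_eq_conj_le[of f, OF ninf F])
  have g_lower: "ereal (xbar * s - F) \<le> ?g s" for s
  proof -
    have "ereal (s * xbar) - f xbar \<le> ?g s"
      unfolding fenchel_conj_def by (rule SUP_upper) simp
    then show ?thesis by (simp add: F mult.commute)
  qed
  obtain s' where s': "?g s' < ereal (xbar * s' + ?c)"
  proof -
    have "ereal (F - \<epsilon>) < fenchel_conj ?g xbar"
      using \<open>\<epsilon> > 0\<close> by (simp add: bi F)
    then obtain s where "ereal (F - \<epsilon>) < ereal (xbar * s) - ?g s"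
      unfolding fenchel_conj_def[of ?g] less_SUP_iff by blast
    then show thesis by (intro that[of s]) (cases "?g s"; simp)
  qed
  have part1: "?g = (\<lambda>s. iota s0 s + c) \<and> a = 0 \<and> b = 0 \<and> edom ?g = {s0} \<and>
      vl = ereal s0 \<and> vu = ereal s0 \<and> \<bar>c\<bar> \<noteq> \<infinity> \<and> f = (\<lambda>x. ereal (s0 * x) - c)"
    if mat: "plq_matrix [(ereal s0, a, b, c)] ?g" for s0 :: real and a b c
  proof -
    obtain d where c: "c = ereal d" and ab: "a = 0" "b = 0" and g: "?g = (\<lambda>s. iota s0 s + c)"
      using mat by (auto simp: plq_matrix_def piecewise_matrix_def split: if_splits)
    have inf: "?g s = \<infinity>" if "s \<noteq> s0" for s
      using that by (simp add: g iota_def c)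
    have "edom ?g = {s0}"
      by (auto simp: g c edom_def iota_def)
    moreover have "eps_subdifferential \<epsilon> f xbar = {s0}"
    proof -
      have "s' = s0" using s' inf by force
      then show ?thesis using s' inf by (force simp: S)
    qed
    moreover have "f = (\<lambda>x. ereal (s0 * x) - c)"
      using fenchel_conj_point_indicator[of s0 d] g bi by (simp add: c)
    ultimately show ?thesis using g ab c by (simp add: vl vu)
  qed
  have l_row: "plq_matrix [(\<infinity>, 0, xbar, ereal \<epsilon> - f xbar)] l"
  proof -
    have "l (p + 1) \<noteq> iota p (p + 1) + ereal d" for p d
      by (simp add: l_eq iota_def)
    then have "l \<noteq> (\<lambda>s. iota p s + ereal d)" for p d
      by metis
    then show ?thesis
      unfolding plq_matrix_def piecewise_matrix_def row by (auto simp: left_end_def l_eq)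
  qed
  have m_eq: "m s = min (?g s) (ereal (xbar * s + ?c))" for s
    by (simp add: m l_eq)
  have m_real: "\<exists>r. m s = ereal r \<and> \<bar>r - (xbar * s + ?c)\<bar> \<le> \<epsilon>" for s
    using g_lower[of s] \<open>\<epsilon> > 0\<close> by (cases "?g s") (auto simp: m_eq min_def)
  have D: "{s. ?g s < ereal (xbar * s + ?c)} = {s. m s \<noteq> ereal (0 * s\<^sup>2 + xbar * s + ?c)}"
    by (auto simp: m_eq min_def)
  have vlD: "vl = Inf (ereal ` {s. m s \<noteq> ereal (0 * s\<^sup>2 + xbar * s + ?c)})"
    and vuD: "vu = Sup (ereal ` {s. m s \<noteq> ereal (0 * s\<^sup>2 + xbar * s + ?c)})"
    using sublevel_ends_eq_strict_sublevel_ends[of f, OF ninf s'] by (simp_all add: vl vu S D)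
  have part2: "(k = 0 \<longrightarrow>
        breakpoint (M ! 0) = \<infinity> \<and> vl = -\<infinity> \<and> vu = \<infinity> \<and>
        \<bar>const_coeff (M ! 0)\<bar> \<noteq> \<infinity> \<and> f = (\<lambda>x. iota xbar x - const_coeff (M ! 0))) \<and>
      (k \<ge> 1 \<longrightarrow>
        \<bar>breakpoint (M ! 0)\<bar> \<noteq> \<infinity> \<and> \<bar>breakpoint (M ! (k - 1))\<bar> \<noteq> \<infinity> \<and>
        vl = (if row_coeffs (M ! 0) = (0, xbar, ereal \<epsilon> - f xbar)
              then breakpoint (M ! 0) else -\<infinity>) \<and>
        vu = (if row_coeffs (M ! k) = (0, xbar, ereal \<epsilon> - f xbar)
              then breakpoint (M ! (k - 1)) else \<infinity>))"
    if min: "minimal_plq_matrix M m" and len: "length M = Suc k" for M k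
  proof -
    have "m \<noteq> (\<lambda>s. iota p s + ereal d)" for p d
      using m_real[of "p + 1"] by (auto simp: iota_def)
    then have M: "piecewise_matrix M m"
      using min by (auto simp: minimal_plq_matrix_def plq_matrix_def split: if_splits)
    have rows_differ: "row_coeffs (M ! i) \<noteq> row_coeffs (M ! Suc i)" if "Suc i < length M" for i
      using min that by (auto simp: minimal_plq_matrix_def)
    show ?thesis
    proof (cases k)
      case 0
      obtain a b e where rc: "row_coeffs (M ! 0) = (a, b, e)" by (cases "row_coeffs (M ! 0)")
      have bp: "breakpoint (M ! 0) = \<infinity>"
        using M len 0 unfolding piecewise_matrix_def by (auto simp: last_conv_nth)
      have m0: "m s = ereal (a * s\<^sup>2 + b * s) + e" for s
        using piecewise_matrix_value[OF M _ rc, of s] len bp by (simp add: left_end_def)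
      obtain d where e: "e = ereal d"
        using m0[of 0] m_real[of 0] by (cases e) auto
      \<comment> \<open>A quadratic within \<open>\<epsilon>\<close> of an affine function differs from it by a constant, and this
        constant is negative because it is so at \<open>s'\<close>.\<close>
      have "a = 0 \<and> b - xbar = 0"
      proof (rule bounded_quadratic_const)
        fix s
        show "\<bar>a * s\<^sup>2 + (b - xbar) * s + (d - ?c)\<bar> \<le> \<epsilon>"
          using m_real[of s] m0[of s] e by (auto simp: algebra_simps)
      qed
      then have m1: "m s = ereal (xbar * s + d)" for s
        using m0 e by simp
      have "d < ?c" using m1[of s'] s' by (auto simp: m_eq min_def split: if_splits)
      then have g: "?g s = ereal (xbar * s + d)" for s
        using m1[of s] by (auto simp: m_eq min_def split: if_splits)
      have "f = fenchel_conj (\<lambda>s. ereal (xbar * s + d))"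
        unfolding g[symmetric] by (rule bi[symmetric])
      also note fenchel_conj_affine
      finally have "f = (\<lambda>x. iota xbar x - ereal d)" .
      moreover have "eps_subdifferential \<epsilon> f xbar = UNIV"
        using \<open>d < ?c\<close> by (auto simp: S g)
      moreover have "Inf (range ereal) = -\<infinity>" "Sup (range ereal) = \<infinity>"
        by (auto intro!: ereal_bot ereal_top Inf_lower Sup_upper)
      ultimately show ?thesis
        using 0 bp rc e by (simp add: vl vu)
    next
      case (Suc j)
      have "\<bar>breakpoint (M ! 0)\<bar> \<noteq> \<infinity>" "\<bar>breakpoint (M ! j)\<bar> \<noteq> \<infinity>"
        using finite_breakpoint[OF M, of 0] finite_breakpoint[OF M, of j] len Suc by auto
      moreover have "vl = (if row_coeffs (M ! 0) = (0, xbar, ereal ?c) then breakpoint (M ! 0) else -\<infinity>)"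
        unfolding vlD using len Suc rows_differ[of 0]
        by (intro Inf_differs_eq_first_breakpoint[OF M]) auto
      moreover have "vu = (if row_coeffs (M ! Suc j) = (0, xbar, ereal ?c) then breakpoint (M ! j) else \<infinity>)"
        unfolding vuD using len Suc rows_differ[of j]
        by (intro Sup_differs_eq_last_breakpoint[OF M]) auto
      ultimately show ?thesis
        unfolding row using Suc by simp
    qed
  qed
  show ?thesis
    by (rule conjI; (intro allI impI)?; (rule part1)?; (rule conjI[OF l_row])?;
        (intro allI impI)?; (elim conjE)?; (rule part2)?; assumption)
qed

end
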